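(* Let $(M,\mu_M,\beta)$ be a module over a left Hom-alternative algebra $(A,\mu,\alpha)$ over $\mathbf{K}$. Then for all $x,y\in A$ and all $m\in M$, $$\mu_M(\alpha(x),\mu_M(y,m))-\mu_M(\mu(x,y),\beta(m))+\mu_M(\alpha(y),\mu_M(x,m))-\mu_M(\mu(y,x),\beta(m))=0.$$
   Context: $\mathbf{K}$ is a field of characteristic $0$; linearity and $\otimes$ are over $\mathbf{K}$. A left Hom-alternative algebra is a triple $(A,\mu,\alpha)$ where $A$ is a $\mathbf{K}$-linear space, $\mu:A\otimes A\to A$ and $\alpha:A\to A$ are linear maps, and $\mu(\alpha(x),\mu(x,y))=\mu(\mu(x,x),\alpha(y))$ for all $x,y\in A$. A module over $(A,\mu,\alpha)$ is a triple $(M,\mu_M,\beta)$ where $M$ is a $\mathbf{K}$-linear space, $\beta:M\to M$ is linear and $\mu_M:A\otimes M\to M$ is a ($\mathbf{K}$-bilinear) map satisfying $\mu_M(\alpha(x),\mu_M(x,m))=\mu_M(\mu(x,x),\beta(m))$ for all $x\in A$, $m\in M$. *)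

theory Defs
  imports Complex_Main
begin

text \<open>
  Vector spaces are given by a type of vectors together with a scalar multiplication, as in
  \<^locale>\<open>vector_space\<close>.  A linear map out of the tensor product of two spaces is
  represented by the corresponding map of two arguments, linear in each of them.
\<close>

definition bilinear_map ::
  "('k::field \<Rightarrow> 'a::ab_group_add \<Rightarrow> 'a) \<Rightarrow> ('k \<Rightarrow> 'b::ab_group_add \<Rightarrow> 'b) \<Rightarrow>
    ('k \<Rightarrow> 'c::ab_group_add \<Rightarrow> 'c) \<Rightarrow> ('a \<Rightarrow> 'b \<Rightarrow> 'c) \<Rightarrow> bool" where
  "bilinear_map sA sB sC f \<longleftrightarrow>
    (\<forall>x. Vector_Spaces.linear sB sC (\<lambda>y. f x y)) \<and> (\<forall>y. Vector_Spaces.linear sA sC (\<lambda>x. f x y))"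

locale left_hom_alternative_algebra = vector_space scaleA
  for scaleA :: "'k::field_char_0 \<Rightarrow> 'a::ab_group_add \<Rightarrow> 'a" +
  fixes \<mu> :: "'a \<Rightarrow> 'a \<Rightarrow> 'a"
    and \<alpha> :: "'a \<Rightarrow> 'a"
  assumes bilinear_mult: "bilinear_map scaleA scaleA scaleA \<mu>"
    and linear_twist: "Vector_Spaces.linear scaleA scaleA \<alpha>"
    and left_hom_alternative: "\<mu> (\<alpha> x) (\<mu> x y) = \<mu> (\<mu> x x) (\<alpha> y)"

locale left_hom_alternative_module =
  left_hom_alternative_algebra scaleA \<mu> \<alpha> + M: vector_space scaleM
  for scaleA :: "'k::field_char_0 \<Rightarrow> 'a::ab_group_add \<Rightarrow> 'a"
    and \<mu> :: "'a \<Rightarrow> 'a \<Rightarrow> 'a"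
    and \<alpha> :: "'a \<Rightarrow> 'a"
    and scaleM :: "'k \<Rightarrow> 'm::ab_group_add \<Rightarrow> 'm" +
  fixes \<mu>\<^sub>M :: "'a \<Rightarrow> 'm \<Rightarrow> 'm"
    and \<beta> :: "'m \<Rightarrow> 'm"
  assumes bilinear_action: "bilinear_map scaleA scaleM scaleM \<mu>\<^sub>M"
    and linear_module_twist: "Vector_Spaces.linear scaleM scaleM \<beta>"
    and module_identity: "\<mu>\<^sub>M (\<alpha> x) (\<mu>\<^sub>M x m) = \<mu>\<^sub>M (\<mu> x x) (\<beta> m)"

end

theory Submission
  imports Defs
begin

text \<open>The claim is the linearization (polarization) of \<open>module_identity\<close>, which
  is quadratic in the algebra element. Put \<open>x + y\<close> in place of \<open>x\<close> and
  expand by additivity of \<alpha>, \<mu> and \<open>\<mu>\<^sub>M\<close>: each side becomes four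
  terms. The two terms with a repeated argument agree on both sides by the identity at
  \<open>x\<close> and at \<open>y\<close>; what remains is the symmetric mixed part, which is the
  claim. The two lemmas below extract from \<open>bilinear_map\<close> the additivity in each
  argument.\<close>

lemma bilinear_map_add_left:
  assumes "bilinear_map sA sB sC f"
  shows "f (x + y) z = f x z + f y z"
proof -
  interpret Vector_Spaces.linear sA sC "\<lambda>x. f x z"
    using assms by (simp add: bilinear_map_def)
  show ?thesis by (rule add)
qed

lemma bilinear_map_add_right:
  assumes "bilinear_map sA sB sC f"
  shows "f x (y + z) = f x y + f x z"
proof -
  interpret Vector_Spaces.linear sB sC "\<lambda>y. f x y"
    using assms by (simp add: bilinear_map_def)
  show ?thesis by (rule add)
qed

theorem proposition3p2:
  fixes scaleA :: "'k::field_char_0 \<Rightarrow> 'a::ab_group_add \<Rightarrow> 'a"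
    and \<mu> :: "'a \<Rightarrow> 'a \<Rightarrow> 'a"
    and \<alpha> :: "'a \<Rightarrow> 'a"
    and scaleM :: "'k \<Rightarrow> 'm::ab_group_add \<Rightarrow> 'm"
    and \<mu>\<^sub>M :: "'a \<Rightarrow> 'm \<Rightarrow> 'm"
    and \<beta> :: "'m \<Rightarrow> 'm"
  assumes "left_hom_alternative_algebra scaleA \<mu> \<alpha>"
    and "left_hom_alternative_module scaleA \<mu> \<alpha> scaleM \<mu>\<^sub>M \<beta>"
  shows "\<forall>x y m. \<mu>\<^sub>M (\<alpha> x) (\<mu>\<^sub>M y m) - \<mu>\<^sub>M (\<mu> x y) (\<beta> m)
    + \<mu>\<^sub>M (\<alpha> y) (\<mu>\<^sub>M x m) - \<mu>\<^sub>M (\<mu> y x) (\<beta> m) = 0"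
proof (intro allI)
  fix x y :: 'a and m :: 'm
  interpret left_hom_alternative_module scaleA \<mu> \<alpha> scaleM \<mu>\<^sub>M \<beta>
    by (fact assms(2))
  interpret twist: Vector_Spaces.linear scaleA scaleA \<alpha>
    by (fact linear_twist)
  note additive = twist.add
    bilinear_map_add_left[OF bilinear_mult] bilinear_map_add_right[OF bilinear_mult]
    bilinear_map_add_left[OF bilinear_action] bilinear_map_add_right[OF bilinear_action]
  \<comment> \<open>After expansion, the instances at \<open>x\<close> and \<open>y\<close> turn the
    diagonal terms on the left into those on the right, so they cancel and leave the cross
    terms.\<close>
  from module_identity[of "x + y" m]
  have "\<mu>\<^sub>M (\<alpha> x) (\<mu>\<^sub>M y m) + \<mu>\<^sub>M (\<alpha> y) (\<mu>\<^sub>M x m) =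
      \<mu>\<^sub>M (\<mu> x y) (\<beta> m) + \<mu>\<^sub>M (\<mu> y x) (\<beta> m)"
    by (simp add: additive module_identity[of x] module_identity[of y] algebra_simps)
  then show "\<mu>\<^sub>M (\<alpha> x) (\<mu>\<^sub>M y m) - \<mu>\<^sub>M (\<mu> x y) (\<beta> m)
    + \<mu>\<^sub>M (\<alpha> y) (\<mu>\<^sub>M x m) - \<mu>\<^sub>M (\<mu> y x) (\<beta> m) = 0"
    by (simp add: algebra_simps)
qed

end
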